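(* Let $(L,A,\cdot,\ell)$ be a left-symmetric Rinehart algebra over a field $\mathbb K$ of characteristic zero and let $N:L\to L$ be a Nijenhuis operator on it. Put $$\mathfrak m(x,y)=\delta N(x,y)=x\cdot N(y)+N(x)\cdot y-N(x\cdot y).$$ Then $\mathfrak m$ generates a deformation of $(L,A,\cdot,\ell)$, i.e. $\mathfrak m_t(x,y)=x\cdot y+t\,\mathfrak m(x,y)$, $\ell_t=\ell+t\,\Xi_{\mathfrak m}$ defines a left-symmetric Rinehart algebra structure $L_t$. Furthermore, this deformation is trivial.
   Context: All vector spaces are over a field $\mathbb K$ of characteristic zero. A left-symmetric Rinehart algebra is a quadruple $(L,A,\cdot,\ell)$ where $A$ is an associative commutative $\mathbb K$-algebra, $L$ is an $A$-module with a bilinear product satisfying $(x\cdot y)\cdot z-x\cdot(y\cdot z)=(y\cdot x)\cdot z-y\cdot(x\cdot z)$, and $\ell:L\to \mathrm{Der}(A)$ is a linear map such that $\ell(x\cdot y-y\cdot x)=\ell(x)\ell(y)-\ell(y)\ell(x)$, $\ell(ax)=a\ell(x)$, $x\cdot(ay)=\ell(x)(a)\,y+a(x\cdot y)$, and $(ax)\cdot y=a(x\cdot y)$ for all $a\in A$, $x,y,z\in L$. A Nijenhuis operator on $(L,A,\cdot,\ell)$ is an $A$-linear map $N:L\to L$ with $N(x)\cdot N(y)-N(x\cdot N(y))-N(N(x)\cdot y)+N^2(x\cdot y)=0$ for all $x,y\in L$. Here $t$ is a formal parameter: $\mathfrak m_t$ is extended $\mathbb K[[t]]$-bilinearly to $L[[t]]$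 and $\ell_t$ correspondingly. $\Xi_{\mathfrak m}:L\to\mathrm{Der}(A)$ is the symbol of $\mathfrak m$, i.e. $\mathfrak m(x,ay)=a\,\mathfrak m(x,y)+\Xi_{\mathfrak m}(x)(a)y$; for $\mathfrak m=\delta N$ it is $\Xi_{\mathfrak m}=\ell\circ N$. The deformation is trivial if there is a family of left-symmetric Rinehart algebra isomorphisms $\mathrm{Id}+tN:L_t\to L$ (identity on $A$), i.e. $(\mathrm{Id}+tN)\mathfrak m_t(x,y)=(\mathrm{Id}+tN)(x)\cdot(\mathrm{Id}+tN)(y)$ and $\ell\circ(\mathrm{Id}+tN)=\ell_t$. *)

theory Defs
  imports "HOL-Computational_Algebra.Formal_Power_Series"
begin

text \<open>
  Everything is set up over a commutative base ring, since the deformed structure lives over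
  \<open>\<bbbK>[[t]]\<close>. Over a field, \<^const>\<open>module\<close> says \<^const>\<open>vector_space\<close> (\<open>module_iff_vector_space\<close>) and
  \<^const>\<open>module_hom\<close> says linear map. The algebra \<open>A\<close> is the type \<open>'a\<close> with its ring multiplication
  and the scalar multiplication \<open>sA\<close>; \<open>'a\<close> has class \<^class>\<open>comm_ring\<close>, so a unit is not required.
\<close>

definition module_bilinear ::
  "('k::comm_ring_1 \<Rightarrow> 'b::ab_group_add \<Rightarrow> 'b) \<Rightarrow> ('k \<Rightarrow> 'c::ab_group_add \<Rightarrow> 'c) \<Rightarrow>
   ('k \<Rightarrow> 'd::ab_group_add \<Rightarrow> 'd) \<Rightarrow> ('b \<Rightarrow> 'c \<Rightarrow> 'd) \<Rightarrow> bool" where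
  "module_bilinear s1 s2 s3 f \<longleftrightarrow>
     (\<forall>x. module_hom s2 s3 (f x)) \<and> (\<forall>y. module_hom s1 s3 (\<lambda>x. f x y))"

locale comm_assoc_algebra = module sA
  for sA :: "'k::comm_ring_1 \<Rightarrow> 'a::comm_ring \<Rightarrow> 'a" +
  assumes scale_mult: "sA c a * b = sA c (a * b)"

text \<open>
  The last axiom covers both conventions: if \<open>A\<close> has a unit, modules are unital; if it has none, the
  axiom is void.
\<close>

locale algebra_module = comm_assoc_algebra sA + L: module sL
  for sA :: "'k::comm_ring_1 \<Rightarrow> 'a::comm_ring \<Rightarrow> 'a"
    and sL :: "'k \<Rightarrow> 'l::ab_group_add \<Rightarrow> 'l" +
  fixes act :: "'a \<Rightarrow> 'l \<Rightarrow> 'l"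
  assumes act_bilinear: "module_bilinear sA sL sL act"
    and act_act: "act a (act b x) = act (a * b) x"
    and act_unit: "(\<And>a. u * a = a) \<Longrightarrow> act u x = x"

definition derivation :: "('k::comm_ring_1 \<Rightarrow> 'a::comm_ring \<Rightarrow> 'a) \<Rightarrow> ('a \<Rightarrow> 'a) \<Rightarrow> bool" where
  "derivation sA D \<longleftrightarrow> module_hom sA sA D \<and> (\<forall>a b. D (a * b) = D a * b + a * D b)"

text \<open>Linear maps \<open>L \<rightarrow> Der(A)\<close>.\<close>

definition linear_into_Der ::
  "('k::comm_ring_1 \<Rightarrow> 'a::comm_ring \<Rightarrow> 'a) \<Rightarrow> ('k \<Rightarrow> 'l::ab_group_add \<Rightarrow> 'l) \<Rightarrow>
   ('l \<Rightarrow> 'a \<Rightarrow> 'a) \<Rightarrow> bool" where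
  "linear_into_Der sA sL f \<longleftrightarrow>
     (\<forall>x. derivation sA (f x)) \<and> (\<forall>a. module_hom sL sA (\<lambda>x. f x a))"

locale left_symmetric_Rinehart_algebra = algebra_module sA sL act
  for sA :: "'k::comm_ring_1 \<Rightarrow> 'a::comm_ring \<Rightarrow> 'a"
    and sL :: "'k \<Rightarrow> 'l::ab_group_add \<Rightarrow> 'l"
    and act :: "'a \<Rightarrow> 'l \<Rightarrow> 'l" +
  fixes mul :: "'l \<Rightarrow> 'l \<Rightarrow> 'l"
    and anchor :: "'l \<Rightarrow> 'a \<Rightarrow> 'a"
  assumes mul_bilinear: "module_bilinear sL sL sL mul"
    and left_symmetric:
      "mul (mul x y) z - mul x (mul y z) = mul (mul y x) z - mul y (mul x z)"
    and anchor_linear: "linear_into_Der sA sL anchor"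
    and anchor_commutator:
      "anchor (mul x y - mul y x) a = anchor x (anchor y a) - anchor y (anchor x a)"
    and anchor_act: "anchor (act a x) b = a * anchor x b"
    and mul_act_right: "mul x (act a y) = act (anchor x a) y + act a (mul x y)"
    and mul_act_left: "mul (act a x) y = act a (mul x y)"

text \<open>
  \<open>\<bbbK>\<close>-linearity is stated next to compatibility with the action because \<open>A\<close> need not have a unit.
\<close>

definition Nijenhuis_operator ::
  "('k::comm_ring_1 \<Rightarrow> 'l::ab_group_add \<Rightarrow> 'l) \<Rightarrow> ('a::comm_ring \<Rightarrow> 'l \<Rightarrow> 'l) \<Rightarrow>
   ('l \<Rightarrow> 'l \<Rightarrow> 'l) \<Rightarrow> ('l \<Rightarrow> 'l) \<Rightarrow> bool" where
  "Nijenhuis_operator sL act mul N \<longleftrightarrow>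
     module_hom sL sL N \<and>
     (\<forall>a x. N (act a x) = act a (N x)) \<and>
     (\<forall>x y. mul (N x) (N y) - N (mul x (N y)) - N (mul (N x) y) + N (N (mul x y)) = 0)"

definition \<delta> :: "('l::ab_group_add \<Rightarrow> 'l \<Rightarrow> 'l) \<Rightarrow> ('l \<Rightarrow> 'l) \<Rightarrow> 'l \<Rightarrow> 'l \<Rightarrow> 'l" where
  "\<delta> mul N x y = mul x (N y) + mul (N x) y - N (mul x y)"

definition is_symbol ::
  "('k::comm_ring_1 \<Rightarrow> 'a::comm_ring \<Rightarrow> 'a) \<Rightarrow> ('k \<Rightarrow> 'l::ab_group_add \<Rightarrow> 'l) \<Rightarrow>
   ('a \<Rightarrow> 'l \<Rightarrow> 'l) \<Rightarrow> ('l \<Rightarrow> 'l \<Rightarrow> 'l) \<Rightarrow> ('l \<Rightarrow> 'a \<Rightarrow> 'a) \<Rightarrow> bool" where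
  "is_symbol sA sL act m \<Xi> \<longleftrightarrow>
     linear_into_Der sA sL \<Xi> \<and>
     (\<forall>x a y. m x (act a y) = act a (m x y) + act (\<Xi> x a) y)"

text \<open>
  \<open>V[[t]]\<close> is the type \<open>'v fps\<close> for \<open>V\<close> of type \<open>'v\<close>. The \<open>\<bbbK>[[t]]\<close>-bilinear extension of \<open>f\<close> sends
  \<open>(\<Sum>\<^sub>i x\<^sub>i t\<^sup>i, \<Sum>\<^sub>j y\<^sub>j t\<^sup>j)\<close> to \<open>\<Sum>\<^sub>i\<^sub>,\<^sub>j f(x\<^sub>i, y\<^sub>j) t\<^sup>i\<^sup>+\<^sup>j\<close>. Applied to a scalar multiplication
  \<open>\<bbbK> \<times> V \<rightarrow> V\<close> it yields the \<open>\<bbbK>[[t]]\<close>-module structure of \<open>V[[t]]\<close>, in which \<open>t\<close> is \<^const>\<open>fps_X\<close>.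
\<close>

definition ext :: "('b::zero \<Rightarrow> 'c::zero \<Rightarrow> 'd::comm_monoid_add) \<Rightarrow> 'b fps \<Rightarrow> 'c fps \<Rightarrow> 'd fps" where
  "ext f x y = Abs_fps (\<lambda>n. \<Sum>i=0..n. f (fps_nth x i) (fps_nth y (n - i)))"

text \<open>
  \<open>f + t g\<close>, extended bilinearly; this serves both for \<open>\<mm>\<^sub>t\<close> and, via \<open>(x, a) \<mapsto> \<ell>\<^sub>t(x)(a)\<close>, for \<open>\<ell>\<^sub>t\<close>,
  which then takes values in the \<open>\<bbbK>[[t]]\<close>-linear derivations of \<open>A[[t]]\<close>.
\<close>

definition first_order ::
  "('k::comm_ring_1 \<Rightarrow> 'd::ab_group_add \<Rightarrow> 'd) \<Rightarrow> ('b::zero \<Rightarrow> 'c::zero \<Rightarrow> 'd) \<Rightarrow> ('b \<Rightarrow> 'c \<Rightarrow> 'd) \<Rightarrow>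
   'b fps \<Rightarrow> 'c fps \<Rightarrow> 'd fps" where
  "first_order s f g x y = ext f x y + ext s fps_X (ext g x y)"

definition generates_deformation ::
  "('k::comm_ring_1 \<Rightarrow> 'a::comm_ring \<Rightarrow> 'a) \<Rightarrow> ('k \<Rightarrow> 'l::ab_group_add \<Rightarrow> 'l) \<Rightarrow>
   ('a \<Rightarrow> 'l \<Rightarrow> 'l) \<Rightarrow> ('l \<Rightarrow> 'l \<Rightarrow> 'l) \<Rightarrow> ('l \<Rightarrow> 'a \<Rightarrow> 'a) \<Rightarrow>
   ('l \<Rightarrow> 'l \<Rightarrow> 'l) \<Rightarrow> ('l \<Rightarrow> 'a \<Rightarrow> 'a) \<Rightarrow> bool" where
  "generates_deformation sA sL act mul anchor m \<Xi> \<longleftrightarrow>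
     left_symmetric_Rinehart_algebra (ext sA) (ext sL) (ext act)
       (first_order sL mul m) (first_order sA anchor \<Xi>)"

text \<open>Isomorphisms that are the identity on the (common) algebra \<open>A\<close>.\<close>

locale left_symmetric_Rinehart_iso =
  source: left_symmetric_Rinehart_algebra sA sL act mul anchor +
  target: left_symmetric_Rinehart_algebra sA sL' act' mul' anchor' +
  module_hom sL sL' \<phi>
  for sA :: "'k::comm_ring_1 \<Rightarrow> 'a::comm_ring \<Rightarrow> 'a"
    and sL :: "'k \<Rightarrow> 'l::ab_group_add \<Rightarrow> 'l"
    and act :: "'a \<Rightarrow> 'l \<Rightarrow> 'l" and mul and anchor
    and sL' :: "'k \<Rightarrow> 'm::ab_group_add \<Rightarrow> 'm"
    and act' :: "'a \<Rightarrow> 'm \<Rightarrow> 'm" and mul' and anchor'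
    and \<phi> :: "'l \<Rightarrow> 'm" +
  assumes bij: "bij \<phi>"
    and hom_act: "\<phi> (act a x) = act' a (\<phi> x)"
    and hom_mul: "\<phi> (mul x y) = mul' (\<phi> x) (\<phi> y)"
    and hom_anchor: "anchor' (\<phi> x) = anchor x"

text \<open>\<open>Id + tN\<close> on \<open>L[[t]]\<close>, with \<open>N\<close> applied coefficientwise.\<close>

definition Id_plus_t ::
  "('k::comm_ring_1 \<Rightarrow> 'l::ab_group_add \<Rightarrow> 'l) \<Rightarrow> ('l \<Rightarrow> 'l) \<Rightarrow> 'l fps \<Rightarrow> 'l fps" where
  "Id_plus_t sL N x = x + ext sL fps_X (Abs_fps (\<lambda>n. N (fps_nth x n)))"

definition trivial_deformation ::
  "('k::comm_ring_1 \<Rightarrow> 'a::comm_ring \<Rightarrow> 'a) \<Rightarrow> ('k \<Rightarrow> 'l::ab_group_add \<Rightarrow> 'l) \<Rightarrow>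
   ('a \<Rightarrow> 'l \<Rightarrow> 'l) \<Rightarrow> ('l \<Rightarrow> 'l \<Rightarrow> 'l) \<Rightarrow> ('l \<Rightarrow> 'a \<Rightarrow> 'a) \<Rightarrow>
   ('l \<Rightarrow> 'l \<Rightarrow> 'l) \<Rightarrow> ('l \<Rightarrow> 'a \<Rightarrow> 'a) \<Rightarrow> bool" where
  "trivial_deformation sA sL act mul anchor m \<Xi> \<longleftrightarrow>
     (\<exists>N :: 'l \<Rightarrow> 'l. left_symmetric_Rinehart_iso (ext sA)
        (ext sL) (ext act) (first_order sL mul m) (first_order sA anchor \<Xi>)
        (ext sL) (ext act) (ext mul) (ext anchor)
        (Id_plus_t sL N))"

end

theory Submission
  imports Defs
begin

text \<open>
  On \<open>L[[t]]\<close> the map \<open>\<phi> = Id + tN\<close> is invertible, because the equation \<open>\<phi> x = y\<close> determines the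
  coefficients of \<open>x\<close> one after the other. The Nijenhuis identity says \<open>N(\<delta>N(x,y)) = N x \<cdot> N y\<close>, and
  with it \<open>\<phi>(\<mm>\<^sub>t(x,y)) = \<phi> x \<cdot> \<phi> y\<close> can be read off from the powers of \<open>t\<close>. So \<open>(\<mm>\<^sub>t, \<ell>\<^sub>t)\<close> is the
  pullback along \<open>\<phi>\<close> of the undeformed structure on \<open>L[[t]]\<close>: this gives the axioms for \<open>L\<^sub>t\<close> and the
  triviality of the deformation together.
\<close>

section \<open>Coefficientwise extension of biadditive maps\<close>

text \<open>Additivity in each argument pulls a map through the finite coefficient sums.
  Compatibility with scalars is kept apart: it involves three arguments and is treated like the
  other ternary axioms.\<close>

locale biadditive =
  fixes f :: "'b::ab_group_add \<Rightarrow> 'c::ab_group_add \<Rightarrow> 'd::ab_group_add"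
  assumes add_left: "f (x + x') y = f x y + f x' y"
    and add_right: "f x (y + y') = f x y + f x y'"
begin

lemma zero_left: "f 0 y = 0"
  using add_left[of 0 0 y] by simp

lemma zero_right: "f x 0 = 0"
  using add_right[of x 0 0] by simp

lemma sum_left: "f (\<Sum>i\<in>I. g i) y = (\<Sum>i\<in>I. f (g i) y)"
  by (induction I rule: infinite_finite_induct) (simp_all add: zero_left add_left)

lemma sum_right: "f x (\<Sum>i\<in>I. g i) = (\<Sum>i\<in>I. f x (g i))"
  by (induction I rule: infinite_finite_induct) (simp_all add: zero_right add_right)

end

lemma ext_nth: "fps_nth (ext f x y) n = (\<Sum>i=0..n. f (fps_nth x i) (fps_nth y (n - i)))"
  by (simp add: ext_def)

lemma ext_add_map: "ext (\<lambda>x y. f x y + g x y) x y = ext f x y + ext g x y"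
  by (rule fps_ext) (simp add: ext_nth sum.distrib)

lemma ext_diff_map:
  fixes f g :: "'b::zero \<Rightarrow> 'c::zero \<Rightarrow> 'd::ab_group_add"
  shows "ext (\<lambda>x y. f x y - g x y) x y = ext f x y - ext g x y"
  by (rule fps_ext) (simp add: ext_nth sum_subtractf)

text \<open>Read from right to left, this turns products in \<open>A[[t]]\<close> into extensions,
  so that the composition rules for \<open>ext\<close> cover them too.\<close>

lemma ext_times: "ext (*) x y = x * y"
  by (rule fps_ext) (simp add: ext_nth fps_mult_nth)

lemma (in biadditive) biadditive_ext: "biadditive (ext f)"
  by unfold_locales (rule fps_ext, simp add: ext_nth add_left add_right sum.distrib)+

text \<open>
  Every axiom involving three arguments becomes an identity between trilinear maps, which may be
  checked before extending to power series.
\<close>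

definition ext3 ::
  "('b::zero \<Rightarrow> 'c::zero \<Rightarrow> 'd::zero \<Rightarrow> 'e::comm_monoid_add) \<Rightarrow> 'b fps \<Rightarrow> 'c fps \<Rightarrow> 'd fps \<Rightarrow> 'e fps"
  where
  "ext3 h x y z = Abs_fps (\<lambda>n. \<Sum>(i, j)\<in>{(i, j). i + j \<le> n}.
     h (fps_nth x i) (fps_nth y j) (fps_nth z (n - i - j)))"

lemma ext3_add_map: "ext3 (\<lambda>x y z. f x y z + g x y z) x y z = ext3 f x y z + ext3 g x y z"
  by (rule fps_ext) (simp add: ext3_def sum.distrib case_prod_unfold)

lemma ext3_diff_map:
  fixes f g :: "'b::zero \<Rightarrow> 'c::zero \<Rightarrow> 'd::zero \<Rightarrow> 'e::ab_group_add"
  shows "ext3 (\<lambda>x y z. f x y z - g x y z) x y z = ext3 f x y z - ext3 g x y z"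
  by (rule fps_ext) (simp add: ext3_def sum_subtractf case_prod_unfold)

text \<open>Interchanges the first two indices of the triangular sum. Terms whose arguments come in
  different orders are thus brought to one order, where their maps can be compared.\<close>

lemma ext3_swap: "ext3 h y x z = ext3 (\<lambda>x y z. h y x z) x y z"
proof (rule fps_ext)
  fix n
  show "fps_nth (ext3 h y x z) n = fps_nth (ext3 (\<lambda>x y z. h y x z) x y z) n"
    unfolding ext3_def fps_nth_Abs_fps
    by (rule sum.reindex_bij_witness[where i = prod.swap and j = prod.swap])
      (auto simp: add.commute diff_right_commute)
qed

lemma (in biadditive) ext_ext_left: "ext f (ext g x y) z = ext3 (\<lambda>x y z. f (g x y) z) x y z"
proof (rule fps_ext)
  fix n
  have "fps_nth (ext f (ext g x y) z) n =
      (\<Sum>k\<le>n. \<Sum>i\<le>k. f (g (fps_nth x i) (fps_nth y (k - i))) (fps_nth z (n - k)))"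
    by (simp add: ext_nth sum_left atLeast0AtMost)
  \<comment> \<open>For \<open>i \<le> k\<close> one has \<open>n - k = n - i - (k - i)\<close>.
    This writes the summand in terms of \<open>i\<close> and \<open>j = k - i\<close>, ready for the
    passage to the triangle \<open>i + j \<le> n\<close>.\<close>
  also have "\<dots> = (\<Sum>k\<le>n. \<Sum>i\<le>k. (\<lambda>i j. f (g (fps_nth x i) (fps_nth y j))
      (fps_nth z (n - i - j))) i (k - i))"
    by (intro sum.cong) auto
  also have "\<dots> = fps_nth (ext3 (\<lambda>x y z. f (g x y) z) x y z) n"
    unfolding ext3_def fps_nth_Abs_fps by (rule sum.triangle_reindex_eq[symmetric])
  finally show "fps_nth (ext f (ext g x y) z) n = fps_nth (ext3 (\<lambda>x y z. f (g x y) z) x y z) n" .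
qed

text \<open>The inner index already ranges over \<open>j \<le> n - i\<close>, so the iterated sum is
  a sum over the triangle without any reindexing.\<close>

lemma (in biadditive) ext_ext_right: "ext f x (ext g y z) = ext3 (\<lambda>x y z. f x (g y z)) x y z"
proof (rule fps_ext)
  fix n :: nat
  have triangle: "{(i, j). i + j \<le> n} = Sigma {..n} (\<lambda>i. {..n - i})"
    by auto
  have "fps_nth (ext f x (ext g y z)) n =
      (\<Sum>i\<le>n. \<Sum>j\<le>n - i. f (fps_nth x i) (g (fps_nth y j) (fps_nth z (n - i - j))))"
    by (simp add: ext_nth sum_right atLeast0AtMost)
  also have "\<dots> = fps_nth (ext3 (\<lambda>x y z. f x (g y z)) x y z) n"
    unfolding ext3_def fps_nth_Abs_fps triangle by (rule sum.Sigma) auto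
  finally show "fps_nth (ext f x (ext g y z)) n = fps_nth (ext3 (\<lambda>x y z. f x (g y z)) x y z) n" .
qed

lemma biadditive_times: "biadditive ((*) :: 'a::comm_ring \<Rightarrow> 'a \<Rightarrow> 'a)"
  by unfold_locales (simp_all add: distrib_left distrib_right)

section \<open>Extension of left-symmetric Rinehart algebras\<close>

lemma module_biadditive: "module s \<Longrightarrow> biadditive s"
  by (simp add: biadditive_def module_def)

text \<open>Only the constant coefficient of the first argument contributes. This settles the unit
  axioms, for scalars as well as for \<open>A\<close>.\<close>

lemma ext_fps_const: "biadditive f \<Longrightarrow> ext f (fps_const c) x = Abs_fps (\<lambda>n. f c (fps_nth x n))"
proof (rule fps_ext)
  fix n
  assume "biadditive f"
  then have "(\<Sum>i=0..n. f (fps_nth (fps_const c) i) (fps_nth x (n - i))) =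
      (\<Sum>i\<in>{0}. f (fps_nth (fps_const c) i) (fps_nth x (n - i)))"
    by (intro sum.mono_neutral_right) (auto simp: biadditive.zero_left)
  then show "fps_nth (ext f (fps_const c) x) n = fps_nth (Abs_fps (\<lambda>n. f c (fps_nth x n))) n"
    by (simp add: ext_nth)
qed

lemma module_ext:
  assumes "module s"
  shows "module (ext s)"
proof -
  interpret module s by fact
  interpret s: biadditive s by (rule module_biadditive) fact
  interpret e: biadditive "ext s" by (rule s.biadditive_ext)
  show ?thesis
  proof
    show "ext s a (ext s b x) = ext s (a * b) x" for a b x
      by (simp only: ext_times[symmetric] s.ext_ext_left s.ext_ext_right) simp
    show "ext s 1 x = x" for x
      \<comment> \<open>\<open>fps_nth_inverse\<close> says that a series is rebuilt from its
        coefficients; it does not concern multiplicative inverses.\<close>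
      using ext_fps_const[OF s.biadditive_axioms, of 1 x] by (simp add: fps_nth_inverse)
  qed (simp_all add: e.add_left e.add_right)
qed

text \<open>Splits bilinearity into additivity, which feeds the composition rules, and scalar
  identities, which are transported through \<open>ext3\<close>.\<close>

lemma module_bilinear_iff:
  assumes "module s1" "module s2" "module s3"
  shows "module_bilinear s1 s2 s3 f \<longleftrightarrow> biadditive f \<and>
    (\<forall>c x y. f (s1 c x) y = s3 c (f x y)) \<and> (\<forall>c x y. f x (s2 c y) = s3 c (f x y))"
  using assms unfolding module_bilinear_def biadditive_def module_hom_iff by blast

lemma module_bilinear_ext:
  assumes modules: "module s1" "module s2" "module s3"
    and "module_bilinear s1 s2 s3 f"
  shows "module_bilinear (ext s1) (ext s2) (ext s3) (ext f)"
proof -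
  have f: "biadditive f" and left: "f (s1 c x) y = s3 c (f x y)"
    and right: "f x (s2 c y) = s3 c (f x y)" for c x y
    using assms module_bilinear_iff[OF modules, of f] by auto
  interpret f: biadditive f by (rule f)
  interpret s3: biadditive s3 using modules(3) by (rule module_biadditive)
  have "ext f (ext s1 c x) y = ext s3 c (ext f x y)" for c x y
    by (simp only: f.ext_ext_left s3.ext_ext_right left)
  \<comment> \<open>The scalar is the second argument on the left but the first on the right, hence
    the swap.\<close>
  moreover have "ext f x (ext s2 c y) = ext s3 c (ext f x y)" for c x y
    by (simp only: f.ext_ext_right s3.ext_ext_right right ext3_swap[of _ c x])
  ultimately show ?thesis
    using modules by (simp add: module_bilinear_iff module_ext f.biadditive_ext)
qed

text \<open>Viewing the map as a bilinear map from \<open>L\<close> and \<open>A\<close> to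
  \<open>A\<close> with a Leibniz rule makes the extension of bilinear maps applicable.\<close>

lemma linear_into_Der_iff:
  assumes "module sA" "module sL"
  shows "linear_into_Der sA sL f \<longleftrightarrow> module_bilinear sL sA sA f \<and>
    (\<forall>x a b. f x (a * b) = f x a * b + a * f x b)"
  unfolding linear_into_Der_def derivation_def module_bilinear_def by blast

lemma linear_into_Der_ext:
  assumes modules: "module sA" "module sL" and f: "linear_into_Der sA sL f"
  shows "linear_into_Der (ext sA) (ext sL) (ext f)"
proof -
  have bil: "module_bilinear sL sA sA f"
    and leibniz: "f x (a * b) = f x a * b + a * f x b" for x a b
    using f modules by (auto simp: linear_into_Der_iff)
  interpret f: biadditive f using bil modules by (simp add: module_bilinear_iff)
  interpret t: biadditive "(*) :: 'b \<Rightarrow> 'b \<Rightarrow> 'b" by (rule biadditive_times)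
  have "ext f x (a * b) = ext f x a * b + a * ext f x b" for x a b
    by (simp only: ext_times[symmetric] f.ext_ext_right t.ext_ext_left t.ext_ext_right
        ext3_swap[of _ a x] ext3_add_map[symmetric] leibniz)
  then show ?thesis
    using modules bil by (simp add: linear_into_Der_iff module_ext module_bilinear_ext)
qed

lemma comm_assoc_algebra_ext:
  assumes "comm_assoc_algebra sA"
  shows "comm_assoc_algebra (ext sA)"
proof -
  interpret comm_assoc_algebra sA by fact
  interpret s: biadditive sA by (rule module_biadditive) unfold_locales
  interpret t: biadditive "(*) :: 'b \<Rightarrow> 'b \<Rightarrow> 'b" by (rule biadditive_times)
  interpret e: module "ext sA" by (rule module_ext) unfold_locales
  show ?thesis
    by unfold_locales
      (simp only: ext_times[symmetric] s.ext_ext_right t.ext_ext_left scale_mult)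
qed

text \<open>Multiplying by a constant \<open>b\<close> and comparing coefficients gives
  \<open>u_0 b = b\<close> and \<open>u_n b = 0\<close> for positive \<open>n\<close>. This serves
  the unit axiom over \<open>A[[t]]\<close>: a unit there comes from a unit of
  \<open>A\<close>.\<close>

lemma fps_unit_const:
  fixes u :: "'a::comm_ring fps"
  assumes "\<And>a. u * a = a"
  shows "u = fps_const (fps_nth u 0)" and "fps_nth u 0 * a = a"
proof -
  have const: "fps_nth u n * b = (if n = 0 then b else 0)" for n b
  proof -
    have "fps_nth (u * fps_const b) n =
        (\<Sum>i=0..n. fps_nth u i * fps_nth (fps_const b) (n - i))"
      by (simp add: fps_mult_nth)
    also have "\<dots> = (\<Sum>i\<in>{n}. fps_nth u i * fps_nth (fps_const b) (n - i))"
      by (intro sum.mono_neutral_right) auto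
    finally show ?thesis
      by (simp add: assms)
  qed
  show "fps_nth u 0 * a = a"
    by (simp add: const)
  show "u = fps_const (fps_nth u 0)"
  proof (rule fps_ext)
    fix n
    \<comment> \<open>The constant coefficient fixes \<open>u_n\<close>; by commutativity the
      product is also \<open>u_n u_0\<close>, which vanishes for positive \<open>n\<close>.\<close>
    have "fps_nth u n = fps_nth u 0 * fps_nth u n"
      by (simp add: const)
    also have "\<dots> = fps_nth u n * fps_nth u 0"
      by (rule mult.commute)
    finally show "fps_nth u n = fps_nth (fps_const (fps_nth u 0)) n"
      by (simp add: const split: if_splits)
  qed
qed

lemma algebra_module_ext:
  assumes "algebra_module sA sL act"
  shows "algebra_module (ext sA) (ext sL) (ext act)"
proof -
  interpret algebra_module sA sL act by fact
  interpret e: comm_assoc_algebra "ext sA"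
    by (rule comm_assoc_algebra_ext) unfold_locales
  interpret eL: module "ext sL" by (rule module_ext) unfold_locales
  interpret act: biadditive act
    using act_bilinear
    by (simp add: module_bilinear_iff module_axioms L.module_axioms)
  show ?thesis
  proof
    show "module_bilinear (ext sA) (ext sL) (ext sL) (ext act)"
      by (intro module_bilinear_ext module_axioms L.module_axioms act_bilinear)
    show "ext act a (ext act b x) = ext act (a * b) x" for a b x
      by (simp only: ext_times[symmetric] act.ext_ext_left act.ext_ext_right act_act)
    show "ext act u x = x" if u: "\<And>a. u * a = a" for u x
    proof -
      have "ext act u x = ext act (fps_const (fps_nth u 0)) x"
        using fps_unit_const(1)[OF u] by simp
      also have "\<dots> = x"
        by (simp add: ext_fps_const[OF act.biadditive_axioms] act_unit fps_unit_const(2)[OF u]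
            fps_nth_inverse)
      finally show ?thesis .
    qed
  qed
qed

text \<open>In each ternary axiom all terms become \<open>ext3\<close> of trilinear maps in one
  common order of arguments; the axiom over the base ring then identifies the maps.\<close>

lemma left_symmetric_Rinehart_algebra_ext:
  assumes "left_symmetric_Rinehart_algebra sA sL act mul anchor"
  shows "left_symmetric_Rinehart_algebra (ext sA) (ext sL) (ext act) (ext mul) (ext anchor)"
proof -
  interpret left_symmetric_Rinehart_algebra sA sL act mul anchor by fact
  interpret e: algebra_module "ext sA" "ext sL" "ext act"
    by (rule algebra_module_ext) unfold_locales
  note modules = module_axioms L.module_axioms
  interpret act: biadditive act
    using act_bilinear by (simp add: module_bilinear_iff modules)
  interpret mul: biadditive mul
    using mul_bilinear by (simp add: module_bilinear_iff modules)
  interpret anchor: biadditive anchor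
    using anchor_linear by (simp add: linear_into_Der_iff module_bilinear_iff modules)
  interpret t: biadditive "(*) :: 'b \<Rightarrow> 'b \<Rightarrow> 'b" by (rule biadditive_times)
  show ?thesis
  proof
    show "module_bilinear (ext sL) (ext sL) (ext sL) (ext mul)"
      by (intro module_bilinear_ext modules mul_bilinear)
    show "linear_into_Der (ext sA) (ext sL) (ext anchor)"
      by (intro linear_into_Der_ext modules anchor_linear)
    show "ext mul (ext mul x y) z - ext mul x (ext mul y z) =
        ext mul (ext mul y x) z - ext mul y (ext mul x z)" for x y z
      by (simp only: mul.ext_ext_left mul.ext_ext_right ext3_swap[of _ y x]
          ext3_diff_map[symmetric] left_symmetric)
    show "ext anchor (ext mul x y - ext mul y x) a =
        ext anchor x (ext anchor y a) - ext anchor y (ext anchor x a)" for x y a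
    proof -
      interpret ea: biadditive "ext anchor" by (rule anchor.biadditive_ext)
      \<comment> \<open>The composition rules take a single extension as argument, so the difference
        is expanded first.\<close>
      have "ext anchor (ext mul x y - ext mul y x) a =
          ext anchor (ext mul x y) a - ext anchor (ext mul y x) a"
        using ea.add_left[of "ext mul x y - ext mul y x" "ext mul y x" a] by simp
      also have "\<dots> = ext3 (\<lambda>x y a. anchor (mul x y) a - anchor (mul y x) a) x y a"
        by (simp only: anchor.ext_ext_left ext3_swap[of _ y x] ext3_diff_map[symmetric])
      \<comment> \<open>The commutator axiom speaks of the anchor of a difference; additivity turns
        it into this equality of maps.\<close>
      also have "(\<lambda>x y a. anchor (mul x y) a - anchor (mul y x) a) =
          (\<lambda>x y a. anchor x (anchor y a) - anchor y (anchor x a))"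
      proof (intro ext)
        fix x y a
        show "anchor (mul x y) a - anchor (mul y x) a =
            anchor x (anchor y a) - anchor y (anchor x a)"
          using anchor.add_left[of "mul x y - mul y x" "mul y x" a] anchor_commutator[of x y a]
          by simp
      qed
      also have "ext3 \<dots> x y a = ext anchor x (ext anchor y a) - ext anchor y (ext anchor x a)"
        by (simp only: anchor.ext_ext_right ext3_swap[of _ y x] ext3_diff_map[symmetric])
      finally show ?thesis .
    qed
    show "ext anchor (ext act a x) b = a * ext anchor x b" for a x b
      by (simp only: ext_times[symmetric] anchor.ext_ext_left t.ext_ext_right anchor_act)
    show "ext mul x (ext act a y) = ext act (ext anchor x a) y + ext act a (ext mul x y)" for x a y
      by (simp only: mul.ext_ext_right act.ext_ext_left act.ext_ext_right ext3_swap[of _ a x]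
          ext3_add_map[symmetric] mul_act_right)
    show "ext mul (ext act a x) y = ext act a (ext mul x y)" for a x y
      by (simp only: mul.ext_ext_left act.ext_ext_right mul_act_left)
  qed
qed

section \<open>Pullback along a bijection\<close>

text \<open>By injectivity of \<open>\<phi>\<close>, an identity in the source module may be checked
  after applying \<open>\<phi>\<close>, where it is an axiom of the target. Identities in
  \<open>A\<close> carry over directly through the anchors.\<close>

lemma left_symmetric_Rinehart_iso_pullback:
  fixes sA :: "'k::comm_ring_1 \<Rightarrow> 'a::comm_ring \<Rightarrow> 'a"
    and sL :: "'k \<Rightarrow> 'l::ab_group_add \<Rightarrow> 'l"
    and sL' :: "'k \<Rightarrow> 'm::ab_group_add \<Rightarrow> 'm"
  assumes target: "left_symmetric_Rinehart_algebra sA sL' act' mul' anchor'"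
    and source: "algebra_module sA sL act"
    and hom: "module_hom sL sL' \<phi>"
    and bij: "bij \<phi>"
    and hom_act: "\<And>a x. \<phi> (act a x) = act' a (\<phi> x)"
    and hom_mul: "\<And>x y. \<phi> (mul x y) = mul' (\<phi> x) (\<phi> y)"
    and hom_anchor: "\<And>x. anchor' (\<phi> x) = anchor x"
  shows "left_symmetric_Rinehart_iso sA sL act mul anchor sL' act' mul' anchor' \<phi>"
proof -
  interpret target: left_symmetric_Rinehart_algebra sA sL' act' mul' anchor' by (rule target)
  interpret source: algebra_module sA sL act by (rule source)
  interpret hom: module_hom sL sL' \<phi> by (rule hom)
  note modules = target.module_axioms source.L.module_axioms target.L.module_axioms
  have inj: "x = y" if "\<phi> x = \<phi> y" for x y
    using that bij by (simp add: bij_def inj_eq)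
  have mul': "biadditive mul'" "mul' (sL' c u) v = sL' c (mul' u v)"
      "mul' u (sL' c v) = sL' c (mul' u v)" for c u v
    using target.mul_bilinear by (auto simp: module_bilinear_iff modules)
  have anchor': "biadditive anchor'" "anchor' (sL' c u) a = sA c (anchor' u a)"
      "anchor' u (sA c a) = sA c (anchor' u a)"
      "anchor' u (a * b) = anchor' u a * b + a * anchor' u b" for c u a b
    using target.anchor_linear by (auto simp: linear_into_Der_iff module_bilinear_iff modules)
  note add' = biadditive.add_left[OF mul'(1)] biadditive.add_right[OF mul'(1)]
    biadditive.add_left[OF anchor'(1)] biadditive.add_right[OF anchor'(1)]
  \<comment> \<open>The reversed \<open>hom_anchor\<close> replaces the source anchor by the target
    anchor after \<open>\<phi>\<close>, so every goal ends up in the target.\<close>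
  note hom_simps = hom.add hom.diff hom.scale hom_act hom_mul hom_anchor[symmetric]
  have "left_symmetric_Rinehart_algebra sA sL act mul anchor"
  proof
    show "module_bilinear sL sL sL mul"
      unfolding module_bilinear_iff[OF modules(2,2,2)] biadditive_def
      by (intro conjI allI inj) (simp_all add: hom_simps add' mul'(2,3))
    show "linear_into_Der sA sL anchor"
      unfolding linear_into_Der_iff[OF modules(1,2)] module_bilinear_iff[OF modules(2,1,1)]
        biadditive_def
      by (simp add: hom_simps add' anchor'(2-4))
    show "mul (mul x y) z - mul x (mul y z) = mul (mul y x) z - mul y (mul x z)" for x y z
      by (rule inj) (simp add: hom_simps target.left_symmetric)
    show "anchor (mul x y - mul y x) a = anchor x (anchor y a) - anchor y (anchor x a)" for x y a
      by (simp add: hom_simps target.anchor_commutator)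
    show "anchor (act a x) b = a * anchor x b" for a x b
      by (simp add: hom_simps target.anchor_act)
    show "mul x (act a y) = act (anchor x a) y + act a (mul x y)" for x a y
      by (rule inj) (simp add: hom_simps target.mul_act_right)
    show "mul (act a x) y = act a (mul x y)" for a x y
      by (rule inj) (simp add: hom_simps target.mul_act_left)
  qed
  then show ?thesis
    by (simp add: left_symmetric_Rinehart_iso_def left_symmetric_Rinehart_iso_axioms_def
        target hom bij hom_act hom_mul hom_anchor)
qed

section \<open>The map \<open>Id + tN\<close>\<close>

text \<open>Multiplication by \<open>t\<close> is a shift: only index 1 of \<open>fps_X\<close>
  contributes.\<close>

lemma ext_fps_X_nth:
  assumes "module s"
  shows "fps_nth (ext s fps_X x) n = (if n = 0 then 0 else fps_nth x (n - 1))"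
proof -
  interpret module s by fact
  show ?thesis
  proof (cases n)
    case 0
    then show ?thesis by (simp add: ext_nth)
  next
    case (Suc m)
    have "fps_nth (ext s fps_X x) n = (\<Sum>i\<in>{1}. s (fps_nth fps_X i) (fps_nth x (n - i)))"
      unfolding ext_nth by (intro sum.mono_neutral_right) (auto simp: Suc)
    then show ?thesis by (simp add: Suc)
  qed
qed

lemma bij_Id_plus_t:
  assumes "module sL"
  shows "bij (Id_plus_t sL N)"
proof -
  have nth: "fps_nth (Id_plus_t sL N x) n =
      fps_nth x n + (if n = 0 then 0 else N (fps_nth x (n - 1)))" for x n
    by (simp add: Id_plus_t_def ext_fps_X_nth[OF assms])
  have "x = y" if "Id_plus_t sL N x = Id_plus_t sL N y" for x y
  proof (rule fps_ext)
    fix n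
    show "fps_nth x n = fps_nth y n"
    proof (induction n)
      case 0
      show ?case using nth[of x 0] nth[of y 0] that by simp
    next
      case (Suc n)
      then show ?case using nth[of x "Suc n"] nth[of y "Suc n"] that by simp
    qed
  qed
  moreover have "\<exists>x. y = Id_plus_t sL N x" for y
  proof
    \<comment> \<open>Forward substitution in \<open>x_0 = y_0\<close>,
      \<open>x_(n+1) + N x_n = y_(n+1)\<close>.\<close>
    let ?c = "rec_nat (fps_nth y 0) (\<lambda>n c. fps_nth y (Suc n) - N c)"
    show "y = Id_plus_t sL N (Abs_fps ?c)"
    proof (rule fps_ext)
      fix n
      show "fps_nth y n = fps_nth (Id_plus_t sL N (Abs_fps ?c)) n"
        by (cases n) (simp_all add: nth)
    qed
  qed
  ultimately show ?thesis
    unfolding bij_def inj_def surj_def by blast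
qed

section \<open>The deformation attached to a Nijenhuis operator\<close>

locale Nijenhuis_Rinehart = left_symmetric_Rinehart_algebra sA sL act mul anchor
  for sA :: "'k::comm_ring_1 \<Rightarrow> 'a::comm_ring \<Rightarrow> 'a"
    and sL :: "'k \<Rightarrow> 'l::ab_group_add \<Rightarrow> 'l"
    and act :: "'a \<Rightarrow> 'l \<Rightarrow> 'l"
    and mul :: "'l \<Rightarrow> 'l \<Rightarrow> 'l"
    and anchor :: "'l \<Rightarrow> 'a \<Rightarrow> 'a" +
  fixes N :: "'l \<Rightarrow> 'l"
  assumes Nijenhuis: "Nijenhuis_operator sL act mul N"
begin

sublocale N: module_hom sL sL N
  using Nijenhuis by (simp add: Nijenhuis_operator_def)

lemma N_act: "N (act a x) = act a (N x)"
  using Nijenhuis by (simp add: Nijenhuis_operator_def)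

text \<open>This is the Nijenhuis identity solved for the product of the images; it matches the
  coefficients of \<open>t^2\<close> in the multiplicativity of \<open>Id + tN\<close>.\<close>

lemma N_\<delta>: "N (\<delta> mul N x y) = mul (N x) (N y)"
proof -
  have "mul (N x) (N y) - N (mul x (N y)) - N (mul (N x) y) + N (N (mul x y)) = 0"
    using Nijenhuis by (simp add: Nijenhuis_operator_def)
  then show ?thesis
    unfolding \<delta>_def by (simp add: N.add N.diff algebra_simps)
qed

sublocale act: biadditive act
  using act_bilinear by (simp add: module_bilinear_iff module_axioms L.module_axioms)

sublocale mul: biadditive mul
  using mul_bilinear by (simp add: module_bilinear_iff module_axioms L.module_axioms)

sublocale anchor: biadditive anchor
  using anchor_linear
  by (simp add: linear_into_Der_iff module_bilinear_iff module_axioms L.module_axioms)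

text \<open>The undeformed structure on power series is the target of
  \<open>Id + tN\<close>.\<close>

sublocale ext: left_symmetric_Rinehart_algebra "ext sA" "ext sL" "ext act" "ext mul" "ext anchor"
  by (rule left_symmetric_Rinehart_algebra_ext) unfold_locales

text \<open>Expanding at \<open>act a y\<close>, the term \<open>act (anchor x a) (N y)\<close>
  arises once from \<open>mul x (N (act a y))\<close> and once, with opposite sign, from
  \<open>N (mul x (act a y))\<close>. What survives besides the multiple by \<open>a\<close> is the
  anchor of \<open>N x\<close>.\<close>

lemma is_symbol_\<delta>: "is_symbol sA sL act (\<delta> mul N) (anchor \<circ> N)"
proof -
  have "linear_into_Der sA sL (anchor \<circ> N)"
    using anchor_linear
    by (simp add: linear_into_Der_iff module_bilinear_iff biadditive_def module_axioms
        L.module_axioms N.add N.scale)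
  moreover have "\<delta> mul N x (act a y) = act a (\<delta> mul N x y) + act (anchor (N x) a) y" for x a y
  proof -
    have "act a (u - v) = act a u - act a v" for u v
      using act.add_right[of a "u - v" v] by simp
    then show ?thesis
      by (simp add: \<delta>_def mul_act_right N_act N.add act.add_right)
  qed
  ultimately show ?thesis
    by (simp add: is_symbol_def)
qed

text \<open>Naming the coefficientwise extension of \<open>N\<close> allows calculation with
  \<open>Id + tN\<close> without looking at coefficients.\<close>

definition N_ext :: "'l fps \<Rightarrow> 'l fps" where
  "N_ext x = Abs_fps (\<lambda>n. N (fps_nth x n))"

lemma Id_plus_t_N_ext: "Id_plus_t sL N x = x + ext sL fps_X (N_ext x)"
  by (simp add: Id_plus_t_def N_ext_def)

text \<open>Additivity carries \<open>N\<close> through the coefficient sum. With the two rules that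
  follow, identities involving \<open>N_ext\<close> reduce to identities between maps on
  \<open>L\<close>.\<close>

lemma N_ext_ext: "N_ext (ext f x y) = ext (\<lambda>x y. N (f x y)) x y"
  by (rule fps_ext) (simp add: N_ext_def ext_nth N.sum)

lemma ext_N_ext_left: "ext f (N_ext x) y = ext (\<lambda>x. f (N x)) x y"
  by (rule fps_ext) (simp add: N_ext_def ext_nth)

lemma ext_N_ext_right: "ext f x (N_ext y) = ext (\<lambda>x y. f x (N y)) x y"
  by (rule fps_ext) (simp add: N_ext_def ext_nth)

lemma N_ext_add: "N_ext (x + y) = N_ext x + N_ext y"
  by (rule fps_ext) (simp add: N_ext_def N.add)

lemma N_ext_scale: "N_ext (ext sL c x) = ext sL c (N_ext x)"
  by (simp add: N_ext_ext ext_N_ext_right N.scale)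

lemma N_ext_act: "N_ext (ext act a x) = ext act a (N_ext x)"
  by (simp add: N_ext_ext ext_N_ext_right N_act)

lemma module_hom_Id_plus_t: "module_hom (ext sL) (ext sL) (Id_plus_t sL N)"
  by unfold_locales
    (simp_all add: Id_plus_t_N_ext N_ext_add N_ext_scale ext.L.scale_right_distrib
      ext.L.scale_left_commute algebra_simps)

text \<open>These parts of bilinearity pull powers of \<open>t\<close> out of the
  operations.\<close>

lemma ext_scale:
  "ext act a (ext sL c x) = ext sL c (ext act a x)"
  "ext mul (ext sL c x) y = ext sL c (ext mul x y)"
  "ext mul x (ext sL c y) = ext sL c (ext mul x y)"
  "ext anchor (ext sL c x) a' = ext sA c (ext anchor x a')"
  using ext.act_bilinear ext.mul_bilinear ext.anchor_linear
  by (simp_all add: linear_into_Der_iff module_bilinear_iff ext.module_axioms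
      ext.L.module_axioms)

lemma Id_plus_t_act: "Id_plus_t sL N (ext act a x) = ext act a (Id_plus_t sL N x)"
  by (simp add: Id_plus_t_N_ext N_ext_act ext_scale
      biadditive.add_right[OF act.biadditive_ext])

lemma Id_plus_t_mul:
  "Id_plus_t sL N (first_order sL mul (\<delta> mul N) x y) =
     ext mul (Id_plus_t sL N x) (Id_plus_t sL N y)"
proof -
  let ?T = "ext sL fps_X"
  have \<delta>: "ext (\<delta> mul N) x y = ext mul x (N_ext y) + ext mul (N_ext x) y - N_ext (ext mul x y)"
    unfolding \<delta>_def by (simp add: ext_add_map ext_diff_map N_ext_ext ext_N_ext_left ext_N_ext_right)
  have N\<delta>: "N_ext (ext (\<delta> mul N) x y) = ext mul (N_ext x) (N_ext y)"
    by (simp add: N_ext_ext ext_N_ext_left ext_N_ext_right N_\<delta>)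
  \<comment> \<open>Grouping by powers of \<open>t\<close>: in degree 1 the term
    \<open>N_ext (ext mul x y)\<close> cancels against the negative term of \<open>\<delta>\<close>,
    leaving the two mixed products; degree 2 is \<open>N\<delta>\<close>.\<close>
  have "Id_plus_t sL N (first_order sL mul (\<delta> mul N) x y) =
      ext mul x y + ?T (ext (\<delta> mul N) x y + N_ext (ext mul x y)) +
      ?T (?T (ext mul (N_ext x) (N_ext y)))"
    by (simp add: Id_plus_t_N_ext first_order_def N_ext_add N_ext_scale N\<delta>
        ext.L.scale_right_distrib algebra_simps)
  also have "\<dots> = ext mul (Id_plus_t sL N x) (Id_plus_t sL N y)"
    by (simp add: \<delta> Id_plus_t_N_ext ext_scale ext.L.scale_right_distrib
        biadditive.add_left[OF mul.biadditive_ext] biadditive.add_right[OF mul.biadditive_ext]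
        algebra_simps)
  finally show ?thesis .
qed

text \<open>Linearity of the anchor expands its value at \<open>x + t N x\<close>, and the
  coefficient of \<open>t\<close> is the symbol \<open>anchor \<circ> N\<close>.\<close>

lemma anchor_Id_plus_t: "ext anchor (Id_plus_t sL N x) = first_order sA anchor (anchor \<circ> N) x"
proof
  show "ext anchor (Id_plus_t sL N x) a = first_order sA anchor (anchor \<circ> N) x a" for a
    by (simp add: Id_plus_t_N_ext first_order_def biadditive.add_left[OF anchor.biadditive_ext]
        ext_scale ext_N_ext_left comp_def)
qed

text \<open>The deformation changes only product and anchor, so source and target share the module
  and the action of \<open>A\<close>.\<close>

lemma left_symmetric_Rinehart_iso_Id_plus_t:
  "left_symmetric_Rinehart_iso (ext sA)
     (ext sL) (ext act) (first_order sL mul (\<delta> mul N)) (first_order sA anchor (anchor \<circ> N))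
     (ext sL) (ext act) (ext mul) (ext anchor) (Id_plus_t sL N)"
  by (rule left_symmetric_Rinehart_iso_pullback)
    (fact ext.left_symmetric_Rinehart_algebra_axioms ext.algebra_module_axioms
      module_hom_Id_plus_t bij_Id_plus_t[OF L.module_axioms] Id_plus_t_act Id_plus_t_mul
      anchor_Id_plus_t)+

end

theorem theorem6p14:
  fixes sA :: "'k::field_char_0 \<Rightarrow> 'a::comm_ring \<Rightarrow> 'a"
    and sL :: "'k \<Rightarrow> 'l::ab_group_add \<Rightarrow> 'l"
    and act :: "'a \<Rightarrow> 'l \<Rightarrow> 'l"
    and mul :: "'l \<Rightarrow> 'l \<Rightarrow> 'l"
    and anchor :: "'l \<Rightarrow> 'a \<Rightarrow> 'a"
    and N :: "'l \<Rightarrow> 'l"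
  assumes "left_symmetric_Rinehart_algebra sA sL act mul anchor"
    and "Nijenhuis_operator sL act mul N"
  shows "is_symbol sA sL act (\<delta> mul N) (anchor \<circ> N) \<and>
    generates_deformation sA sL act mul anchor (\<delta> mul N) (anchor \<circ> N) \<and>
    trivial_deformation sA sL act mul anchor (\<delta> mul N) (anchor \<circ> N)"
proof -
  interpret Nijenhuis_Rinehart sA sL act mul anchor N
    by (intro Nijenhuis_Rinehart.intro Nijenhuis_Rinehart_axioms.intro assms)
  show ?thesis
    \<comment> \<open>The isomorphism predicate contains the axioms of its source, which is the
      deformed algebra; the witness for triviality is \<open>N\<close> itself.\<close>
    unfolding generates_deformation_def trivial_deformation_def
    using is_symbol_\<delta> left_symmetric_Rinehart_iso_Id_plus_t
      left_symmetric_Rinehart_iso.axioms(1)[OF left_symmetric_Rinehart_iso_Id_plus_t]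
    by blast
qed

end
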